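(* Let $m_1,m_2,m_3>0$ and let $q_0\in\mathbb{R}^6$ be the Lagrange equilateral triangle central configuration of the planar Newtonian three-body problem with these masses, centered at its center of mass and normalized so that $q_0^\top Mq_0=1$. Let $k=\sqrt{U(q_0)}$, and let $\alpha$ and $\beta$ be minus one half of the two eigenvalues of the reduced Hessian $D^2V_{\mathrm{red}}(0)=B^\top D^2V(q_0)B$ of the effective potential $V$. Then the linear stability condition $$\sqrt{\alpha}+\sqrt{\beta}<\sqrt{2}\,k$$ for the relative equilibrium corresponding to $q_0$ is equivalent to Routh's classical criterion $$\frac{m_1m_2+m_1m_3+m_2m_3}{(m_1+m_2+m_3)^2}<\frac{1}{27}.$$
   Context: Configurations are $q=(q_1,q_2,q_3)\in(\mathbb{R}^2)^3=\mathbb{R}^6$; the mass matrix is $M=\mathrm{diag}(m_1\mathbb{I}_2,m_2\mathbb{I}_2,m_3\mathbb{I}_2)$, with $\langle u,w\rangle_M=u^\top Mw$ and $|q|_M^2=q^\top Mq$. The Newtonian potential (gravitational constant $1$) is $U(q)=\sum_{i<j}\frac{m_im_j}{|q_i-q_j|}$. A Lagrange equilateral triangle central configuration is a configuration in which $q_1,q_2,q_3$ are the vertices of an equilateral triangle, with center of mass $\sum_i m_iq_i=0$. It satisfies $M^{-1}\nabla U(q_0)+U(q_0)q_0=0$ when $|q_0|_M=1$, and generates a relative equilibrium rotating rigidly with angular velocity $k=\sqrt{U(q_0)}$. Passing to coordinates rotating with angular velocity $k$, the effective potential is $V(q)=-U(q)-\tfrac12k^2|q|_M^2$. Let $J$ act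 on $\mathbb{R}^6=(\mathbb{R}^2)^3$ by applying $\begin{pmatrix}0&-1\\1&0\end{pmatrix}$ in each $\mathbb{R}^2$ factor. Put $v_1=(1,0,1,0,1,0)$, $v_2=(0,1,0,1,0,1)$, $v_3=q_0$, $v_4=Jq_0$; let $v_5$ be a vector with $|v_5|_M=1$ that is $M$-orthogonal to $v_1,v_2,v_3,v_4$, let $v_6=Jv_5$, and let $B=[\,v_5\ \ v_6\,]\in\mathbb{R}^{6\times2}$. The reduced potential is $V_{\mathrm{red}}(z)=V(Bz)$ for the shape coordinate $z\in\mathbb{R}^2$, the relative equilibrium corresponding to $z_0=0$; its reduced Hessian is $D^2V_{\mathrm{red}}(0)=B^\top D^2V(q_0)B=-B^\top D^2U(q_0)B-k^2\mathbb{I}_2$. *)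

theory Defs
  imports "Jordan_Normal_Form.Char_Poly" "HOL-Analysis.Analysis"
begin

(* Matrices of fixed small size are taken from Jordan_Normal_Form, because that is where the
   characteristic polynomial is; "$", "vec" and the inner product are those of HOL-Analysis. *)
no_notation Matrix.vec_index (infixl \<open>$\<close> 100)
no_notation Matrix.scalar_prod (infix \<open>\<bullet>\<close> 70)
hide_const (open) Matrix.vec

(* (R^2)^3; q $ i is the position of the i-th body. In the index type 3 the numerals 1, 2, 3
   are the three distinct elements. *)
type_synonym config = "real ^ 2 ^ 3"

definition inner_M :: "real ^ 3 \<Rightarrow> config \<Rightarrow> config \<Rightarrow> real" where
  "inner_M m u w = (\<Sum>i\<in>UNIV. m $ i * (u $ i \<bullet> w $ i))"

definition newton_U :: "real ^ 3 \<Rightarrow> config \<Rightarrow> real" where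
  "newton_U m q =
     m $ 1 * m $ 2 / norm (q $ 1 - q $ 2) +
     m $ 1 * m $ 3 / norm (q $ 1 - q $ 3) +
     m $ 2 * m $ 3 / norm (q $ 2 - q $ 3)"

definition effective_V :: "real ^ 3 \<Rightarrow> real \<Rightarrow> config \<Rightarrow> real" where
  "effective_V m k q = - newton_U m q - 1 / 2 * k\<^sup>2 * inner_M m q q"

definition lagrange_configuration :: "real ^ 3 \<Rightarrow> config \<Rightarrow> bool" where
  "lagrange_configuration m q \<longleftrightarrow>
     q $ 1 \<noteq> q $ 2 \<and>
     dist (q $ 1) (q $ 2) = dist (q $ 2) (q $ 3) \<and>
     dist (q $ 2) (q $ 3) = dist (q $ 3) (q $ 1) \<and>
     (\<Sum>i\<in>UNIV. m $ i *\<^sub>R q $ i) = 0"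

definition J :: "config \<Rightarrow> config" where
  "J q = (\<chi> i. vector [- (q $ i $ 2), q $ i $ 1])"

definition v1 :: config where "v1 = (\<chi> i. vector [1, 0])"

definition v2 :: config where "v2 = (\<chi> i. vector [0, 1])"

(* D^2 f(x) as a bilinear form: u^T D^2 f(x) w. *)
definition second_derivative :: "('a::real_normed_vector \<Rightarrow> real) \<Rightarrow> 'a \<Rightarrow> 'a \<Rightarrow> 'a \<Rightarrow> real" where
  "second_derivative f x u w =
     frechet_derivative (\<lambda>y. frechet_derivative f (at y) w) (at x) u"

(* The 2x2 matrix B^T D^2 f(x) B, where B has the columns b ! 0 and b ! 1. *)
definition reduced_hessian :: "('a::real_normed_vector \<Rightarrow> real) \<Rightarrow> 'a \<Rightarrow> 'a list \<Rightarrow> real mat" where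
  "reduced_hessian f x b = Matrix.mat 2 2 (\<lambda>(i, j). second_derivative f x (b ! i) (b ! j))"

end

theory Submission
  imports Defs
begin

text \<open>
  Let \<open>r\<close> be the side of the triangle, \<open>T\<close> the total mass and \<open>P\<close> the sum of the products of two
  masses. Lagrange's identity \<open>\<Sum> m\<^sub>i m\<^sub>j |u\<^sub>i - u\<^sub>j|\<^sup>2 = T |u|\<^sup>2\<close> for vectors with barycentre \<open>0\<close>
  (\<open>lagrange_identity\<close>) gives \<open>T = P r\<^sup>2\<close>, whence \<open>k\<^sup>2 = T / r\<^sup>3\<close>. It also shows that, in the effective
  potential, the isotropic part of the gravitational Hessian cancels the centrifugal term. What remains of
  the reduced Hessian is \<open>-3 / r\<^sup>5\<close> times the Gram matrix, weighted by the
  \<open>m\<^sub>i m\<^sub>j\<close>, of the scalar products of the two shape vectors with the sides (\<open>second_derivative_at_lagrange\<close>).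

  Identify the plane with the complex numbers. Then the trace of this Gram matrix is \<open>r\<^sup>2 T\<close>, again by
  Lagrange's identity. For the determinant, the conditions on the shape vector \<open>u\<close> say that the
  \<open>m\<^sub>i u\<^sub>i\<close> are proportional to \<open>1\<close>, \<open>w\<close>, \<open>w\<^sup>2\<close> for a primitive cube root of unity \<open>w\<close>
  (\<open>shape_vector_form\<close>), and the Cauchy-Binet formula then yields \<open>3/4 P r\<^sup>4\<close>
  (\<open>shape_gram_determinant\<close>).

  Consequently \<open>\<alpha> + \<beta> = 3/2 k\<^sup>2\<close> and \<open>\<alpha> \<beta> = 27 P / (16 r\<^sup>6)\<close>. Both numbers are nonnegative, and squaring
  twice turns \<open>\<surd>\<alpha> + \<surd>\<beta> < \<surd>2 k\<close> into \<open>16 \<alpha> \<beta> < k\<^sup>4 = T\<^sup>2 / r\<^sup>6\<close> (\<open>sum_of_square_roots_less_iff\<close>),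
  that is, \<open>27 P < T\<^sup>2\<close>.
\<close>

section \<open>Derivatives of the effective potential\<close>

definition pair_sum :: "real ^ 3 \<Rightarrow> (3 \<Rightarrow> 3 \<Rightarrow> real) \<Rightarrow> real" where
  "pair_sum m f = m $ 1 * m $ 2 * f 1 2 + m $ 1 * m $ 3 * f 1 3 + m $ 2 * m $ 3 * f 2 3"

lemma has_derivative_inverse_norm_linear:
  fixes L :: "'a::real_normed_vector \<Rightarrow> 'b::real_inner"
  assumes L: "bounded_linear L" and nz: "L x \<noteq> 0"
  shows "((\<lambda>y. 1 / norm (L y)) has_derivative (\<lambda>h. - (L x \<bullet> L h) / norm (L x) ^ 3)) (at x)"
proof -
  have dL: "(L has_derivative L) (at x)"
    using L by (rule bounded_linear_imp_has_derivative)
  have "((\<lambda>y. norm (L y)) has_derivative (\<lambda>h. L h \<bullet> sgn (L x))) (at x)"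
    using has_derivative_compose[OF dL has_derivative_norm[OF nz]] .
  then have "((\<lambda>y. 1 / norm (L y)) has_derivative
      (\<lambda>h. - 1 * (inverse (norm (L x)) * (L h \<bullet> sgn (L x)) * inverse (norm (L x))) + 0 / norm (L x))) (at x)"
    using nz by (intro has_derivative_divide) (auto intro: has_derivative_const)
  then show ?thesis
    by (rule has_derivative_eq_rhs)
       (auto simp: fun_eq_iff sgn_div_norm inner_commute power3_eq_cube field_simps)
qed

text \<open>
  Fixing the second direction turns the gradient of an inverse distance into this scalar function,
  so that a second Frechet derivative is again a first derivative.
\<close>

lemma has_derivative_inverse_square_force:
  fixes L :: "'a::real_normed_vector \<Rightarrow> 'b::real_inner"
  assumes L: "bounded_linear L" and nz: "L x \<noteq> 0"
  shows "((\<lambda>y. (L y \<bullet> c) / norm (L y) ^ 3) has_derivative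
      (\<lambda>h. (L h \<bullet> c) / norm (L x) ^ 3 - 3 * (L x \<bullet> L h) * (L x \<bullet> c) / norm (L x) ^ 5)) (at x)"
proof -
  have dL: "(L has_derivative L) (at x)"
    using L by (rule bounded_linear_imp_has_derivative)
  have "((\<lambda>y. (L y \<bullet> c) * (1 / norm (L y)) ^ 3) has_derivative
      (\<lambda>h. (L x \<bullet> c) * (of_nat 3 * (- (L x \<bullet> L h) / norm (L x) ^ 3) * (1 / norm (L x)) ^ (3 - 1))
        + (L h \<bullet> c) * (1 / norm (L x)) ^ 3)) (at x)"
    by (intro has_derivative_mult has_derivative_power has_derivative_inner_left dL
        has_derivative_inverse_norm_linear L nz)
  then have "((\<lambda>y. (L y \<bullet> c) * (1 / norm (L y)) ^ 3) has_derivative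
      (\<lambda>h. (L h \<bullet> c) / norm (L x) ^ 3 - 3 * (L x \<bullet> L h) * (L x \<bullet> c) / norm (L x) ^ 5)) (at x)"
  proof (rule has_derivative_eq_rhs, intro ext)
    fix h
    have "norm (L x) ^ 5 = norm (L x) ^ 3 * norm (L x) ^ 2"
      by (simp flip: power_add)
    then show "(L x \<bullet> c) * (of_nat 3 * (- (L x \<bullet> L h) / norm (L x) ^ 3) * (1 / norm (L x)) ^ (3 - 1))
        + (L h \<bullet> c) * (1 / norm (L x)) ^ 3
      = (L h \<bullet> c) / norm (L x) ^ 3 - 3 * (L x \<bullet> L h) * (L x \<bullet> c) / norm (L x) ^ 5"
      by (simp add: power_one_over)
  qed
  then show ?thesis
    by (simp add: power_one_over)
qed

lemma bounded_linear_separation: "bounded_linear (\<lambda>y :: 'a::real_normed_vector ^ 'n. y $ i - y $ j)"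
  by (intro bounded_linear_sub bounded_linear_vec_nth)

lemma inner_M_expand:
  "inner_M m u w = m $ 1 * (u $ 1 \<bullet> w $ 1) + m $ 2 * (u $ 2 \<bullet> w $ 2) + m $ 3 * (u $ 3 \<bullet> w $ 3)"
  by (simp add: inner_M_def sum_3)

definition collision_free :: "config \<Rightarrow> bool" where
  "collision_free y \<longleftrightarrow> y $ 1 \<noteq> y $ 2 \<and> y $ 1 \<noteq> y $ 3 \<and> y $ 2 \<noteq> y $ 3"

text \<open>
  The formula for the first derivative of the potential holds off collisions only. Differentiating
  it once more at a point needs it in a whole neighbourhood of that point.
\<close>

lemma open_collision_free: "open {y. collision_free y}"
  unfolding collision_free_def
  by (intro open_Collect_conj open_Collect_neq continuous_intros)

lemma has_derivative_effective_V:
  assumes "collision_free y"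
  shows "(effective_V m k has_derivative
      (\<lambda>h. pair_sum m (\<lambda>i j. ((y $ i - y $ j) \<bullet> (h $ i - h $ j)) / norm (y $ i - y $ j) ^ 3)
        - k\<^sup>2 * inner_M m y h)) (at y)"
proof -
  have D: "((\<lambda>y. 1 / norm (y $ i - y $ j)) has_derivative
      (\<lambda>h. - ((y $ i - y $ j) \<bullet> (h $ i - h $ j)) / norm (y $ i - y $ j) ^ 3)) (at y)"
    if "y $ i \<noteq> y $ j" for i j
    using has_derivative_inverse_norm_linear[OF bounded_linear_separation] that by simp
  have n: "((\<lambda>y. y $ i) has_derivative (\<lambda>h. h $ i)) (at y)" for i
    by (rule bounded_linear_imp_has_derivative) auto
  have "((\<lambda>y. inner_M m y y) has_derivative (\<lambda>h.
      m $ 1 * (y $ 1 \<bullet> h $ 1 + h $ 1 \<bullet> y $ 1) + m $ 2 * (y $ 2 \<bullet> h $ 2 + h $ 2 \<bullet> y $ 2)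
      + m $ 3 * (y $ 3 \<bullet> h $ 3 + h $ 3 \<bullet> y $ 3))) (at y)"
    unfolding inner_M_expand
    by (intro has_derivative_add has_derivative_mult_right has_derivative_inner n)
  then have I: "((\<lambda>y. inner_M m y y) has_derivative (\<lambda>h. 2 * inner_M m y h)) (at y)"
    by (rule has_derivative_eq_rhs) (simp add: fun_eq_iff inner_M_expand inner_commute)
  have "((\<lambda>y. newton_U m y) has_derivative (\<lambda>h. pair_sum m (\<lambda>i j.
      - ((y $ i - y $ j) \<bullet> (h $ i - h $ j)) / norm (y $ i - y $ j) ^ 3))) (at y)"
    unfolding newton_U_def pair_sum_def
    using has_derivative_mult_right[OF D, of 1 2 "m $ 1 * m $ 2"]
      has_derivative_mult_right[OF D, of 1 3 "m $ 1 * m $ 3"]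
      has_derivative_mult_right[OF D, of 2 3 "m $ 2 * m $ 3"] assms
    by (intro has_derivative_add) (simp_all add: collision_free_def)
  from has_derivative_diff[OF has_derivative_minus[OF this] has_derivative_mult_right[OF I, of "1 / 2 * k\<^sup>2"]]
  show ?thesis
    unfolding effective_V_def by (rule has_derivative_eq_rhs) (simp add: fun_eq_iff pair_sum_def)
qed

lemma second_derivative_effective_V:
  assumes q: "collision_free q"
  shows "second_derivative (effective_V m k) q u w =
    pair_sum m (\<lambda>i j. ((u $ i - u $ j) \<bullet> (w $ i - w $ j)) / norm (q $ i - q $ j) ^ 3
      - 3 * ((q $ i - q $ j) \<bullet> (u $ i - u $ j)) * ((q $ i - q $ j) \<bullet> (w $ i - w $ j))
        / norm (q $ i - q $ j) ^ 5)
    - k\<^sup>2 * inner_M m u w"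
proof -
  define F where "F = (\<lambda>y. pair_sum m (\<lambda>i j.
      ((y $ i - y $ j) \<bullet> (w $ i - w $ j)) / norm (y $ i - y $ j) ^ 3) - k\<^sup>2 * inner_M m y w)"
  have D: "((\<lambda>y. ((y $ i - y $ j) \<bullet> (w $ i - w $ j)) / norm (y $ i - y $ j) ^ 3) has_derivative
      (\<lambda>h. ((h $ i - h $ j) \<bullet> (w $ i - w $ j)) / norm (q $ i - q $ j) ^ 3
      - 3 * ((q $ i - q $ j) \<bullet> (h $ i - h $ j)) * ((q $ i - q $ j) \<bullet> (w $ i - w $ j))
        / norm (q $ i - q $ j) ^ 5)) (at q)" if "q $ i \<noteq> q $ j" for i j
    using has_derivative_inverse_square_force[OF bounded_linear_separation] that by simp
  have n: "((\<lambda>y. y $ i) has_derivative (\<lambda>h. h $ i)) (at q)" for i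
    by (rule bounded_linear_imp_has_derivative) auto
  have DF: "(F has_derivative (\<lambda>h. pair_sum m (\<lambda>i j.
      ((h $ i - h $ j) \<bullet> (w $ i - w $ j)) / norm (q $ i - q $ j) ^ 3
      - 3 * ((q $ i - q $ j) \<bullet> (h $ i - h $ j)) * ((q $ i - q $ j) \<bullet> (w $ i - w $ j))
        / norm (q $ i - q $ j) ^ 5) - k\<^sup>2 * inner_M m h w)) (at q)"
    unfolding F_def pair_sum_def inner_M_expand
    by (intro has_derivative_diff has_derivative_add has_derivative_mult_right
        has_derivative_inner_left n D) (use q in \<open>auto simp: collision_free_def\<close>)
  have F: "F y = frechet_derivative (effective_V m k) (at y) w" if "y \<in> {y. collision_free y}" for y
    unfolding F_def
    by (rule fun_cong[OF frechet_derivative_at[OF has_derivative_effective_V]]) (use that in simp)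
  have D2: "((\<lambda>y. frechet_derivative (effective_V m k) (at y) w) has_derivative
      (\<lambda>h. pair_sum m (\<lambda>i j.
      ((h $ i - h $ j) \<bullet> (w $ i - w $ j)) / norm (q $ i - q $ j) ^ 3
      - 3 * ((q $ i - q $ j) \<bullet> (h $ i - h $ j)) * ((q $ i - q $ j) \<bullet> (w $ i - w $ j))
        / norm (q $ i - q $ j) ^ 5) - k\<^sup>2 * inner_M m h w)) (at q)"
    by (rule has_derivative_transform_within_open[OF DF open_collision_free _ F]) (use q in simp_all)
  show ?thesis
    unfolding second_derivative_def by (rule fun_cong[OF frechet_derivative_at[OF D2], symmetric])
qed

section \<open>Shape vectors of an equilateral triangle\<close>

text \<open>
  With \<open>w = a / b\<close>, both \<open>w\<close> and \<open>w + 1\<close> lie on the unit circle. The circles centred at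
  \<open>0\<close> and \<open>-1\<close> meet exactly in the two primitive cube roots of unity. This is how an
  equilateral triangle of either orientation is handled at once.
\<close>

lemma equal_norms_cube_root_of_unity:
  fixes a b :: complex
  assumes "norm a = norm b" "norm (a + b) = norm b" "b \<noteq> 0"
  obtains w where "a = w * b" "w\<^sup>2 + w + 1 = 0"
proof
  define w where "w = a / b"
  show "a = w * b" using assms by (simp add: w_def)
  have "norm w = 1"
    using assms by (simp add: w_def norm_divide)
  moreover have "w + 1 = (a + b) / b"
    using assms by (simp add: w_def add_divide_distrib)
  then have "norm (w + 1) = 1"
    using assms by (simp add: norm_divide)
  ultimately have "norm w = 1" "norm (w + 1) = 1" .
  then have "(Re w)\<^sup>2 + (Im w)\<^sup>2 = 1" "(Re w + 1)\<^sup>2 + (Im w)\<^sup>2 = 1"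
    by (auto simp: cmod_def real_sqrt_eq_1_iff)
  note on_circles = this
  have re: "Re w = -1/2"
    using on_circles by (simp add: power2_sum)
  with on_circles(1) have im: "(Im w)\<^sup>2 = 3/4"
    by (simp add: power2_eq_square)
  show "w\<^sup>2 + w + 1 = 0"
    using re im by (simp add: complex_eq_iff power2_eq_square)
qed

text \<open>
  The Cauchy-Binet formula for the Gram matrix of three weighted planar vectors: the cross product
  of the vectors \<open>Z1\<close> and \<open>Z2\<close> is \<open>Im (Z1 * cnj Z2)\<close> up to sign.
\<close>

lemma weighted_gram_determinant:
  fixes p1 p2 p3 :: real and Z1 Z2 Z3 :: complex
  shows "(p1 * (Re Z1)\<^sup>2 + p2 * (Re Z2)\<^sup>2 + p3 * (Re Z3)\<^sup>2) * (p1 * (Im Z1)\<^sup>2 + p2 * (Im Z2)\<^sup>2 + p3 * (Im Z3)\<^sup>2)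
      - (p1 * (Re Z1 * Im Z1) + p2 * (Re Z2 * Im Z2) + p3 * (Re Z3 * Im Z3))\<^sup>2
    = p1 * p2 * (Im (Z1 * cnj Z2))\<^sup>2 + p1 * p3 * (Im (Z1 * cnj Z3))\<^sup>2 + p2 * p3 * (Im (Z2 * cnj Z3))\<^sup>2"
  by (simp add: power2_eq_square algebra_simps)

text \<open>
  The real orthogonality to translations, to the configuration and to its rotation by a right angle
  amounts to two complex linear equations for the three complex numbers \<open>m1 * u1\<close>, \<open>m2 * u2\<close>,
  \<open>m3 * u3\<close>. Their solutions form a complex line. For an equilateral triangle this line is spanned by
  \<open>(1, w, w\<^sup>2)\<close>: the weighted shape vector is itself an equilateral triangle, with the
  orientation opposite to that of \<open>q\<close>.
\<close>

lemma shape_vector_form: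
  fixes m1 m2 m3 :: real and q1 q2 q3 u1 u2 u3 :: complex
  assumes "q1 \<noteq> q2" "norm (q1 - q2) = norm (q2 - q3)" "norm (q2 - q3) = norm (q3 - q1)"
    and bary: "m1 * u1 + m2 * u2 + m3 * u3 = 0"
    and orth: "m1 * (cnj q1 * u1) + m2 * (cnj q2 * u2) + m3 * (cnj q3 * u3) = 0"
  obtains w where "w\<^sup>2 + w + 1 = 0" "q2 - q3 = cnj w * (q1 - q2)"
    "m2 * u2 = w * (m1 * u1)" "m3 * u3 = w\<^sup>2 * (m1 * u1)"
proof -
  have "q1 - q2 \<noteq> 0" "norm (q2 - q3) = norm (q1 - q2)" "norm ((q2 - q3) + (q1 - q2)) = norm (q1 - q2)"
    using assms(1-3) by (auto simp: norm_minus_commute)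
  then obtain v where v: "q2 - q3 = v * (q1 - q2)" "v\<^sup>2 + v + 1 = 0"
    using equal_norms_cube_root_of_unity by metis
  define w where "w = cnj v"
  have w: "w\<^sup>2 + w + 1 = 0"
    using arg_cong[OF v(2), of cnj] by (simp add: w_def)
  have q13: "q1 - q3 = (v + 1) * (q1 - q2)"
    using v(1) by (simp add: algebra_simps)
  have "cnj (q1 - q3) * (m1 * u1) + cnj (q2 - q3) * (m2 * u2)
      = (m1 * (cnj q1 * u1) + m2 * (cnj q2 * u2) + m3 * (cnj q3 * u3))
        - cnj q3 * (m1 * u1 + m2 * u2 + m3 * u3)"
    by (simp add: algebra_simps)
  also have "\<dots> = 0" unfolding orth bary by simp
  finally have "cnj (q1 - q3) * (m1 * u1) + cnj (q2 - q3) * (m2 * u2) = 0" .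
  then have "cnj (q1 - q2) * ((w + 1) * (m1 * u1) + w * (m2 * u2)) = 0"
    unfolding q13 v(1) w_def by (simp add: algebra_simps)
  then have e: "(w + 1) * (m1 * u1) + w * (m2 * u2) = 0"
    using assms(1) by simp
  have "w \<noteq> 0" using w by auto
  moreover have "w * (m2 * u2 - w * (m1 * u1))
      = ((w + 1) * (m1 * u1) + w * (m2 * u2)) - (w\<^sup>2 + w + 1) * (m1 * u1)"
    by (simp add: power2_eq_square algebra_simps)
  then have "w * (m2 * u2 - w * (m1 * u1)) = 0"
    unfolding e w by simp
  ultimately have u2: "m2 * u2 = w * (m1 * u1)" by simp
  have "m3 * u3 - w\<^sup>2 * (m1 * u1)
      = (m1 * u1 + m2 * u2 + m3 * u3) - (m2 * u2 - w * (m1 * u1)) - (w\<^sup>2 + w + 1) * (m1 * u1)"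
    by (simp add: algebra_simps)
  moreover have "m2 * u2 - w * (m1 * u1) = 0" using u2 by simp
  ultimately have "m3 * u3 = w\<^sup>2 * (m1 * u1)"
    by (simp only: bary w mult_zero_left diff_0_right right_minus_eq)
  then show ?thesis using that[OF w] u2 v(1) by (simp add: w_def)
qed

text \<open>
  In terms of \<open>c = m1 * u1\<close> and \<open>Z = cnj (q1 - q2) * c\<close>, the cross product of any two of
  \<open>Z12\<close>, \<open>Z13\<close>, \<open>Z23\<close> equals, up to sign, \<open>(norm Z)\<^sup>2 * (sqrt 3 / 2) * N\<close> divided
  by the mass that the two pairs share, where \<open>N = 1/m1 + 1/m2 + 1/m3\<close>. The normalization of \<open>u\<close> says
  \<open>(norm c)\<^sup>2 * N = 1\<close>. In the Cauchy-Binet sum the square of the shared mass cancels and leaves the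
  product of the other two masses, so the sum is symmetric in the masses.
\<close>

lemma shape_gram_determinant:
  fixes m1 m2 m3 :: real and q1 q2 q3 u1 u2 u3 :: complex
  assumes m: "m1 > 0" "m2 > 0" "m3 > 0"
    and tri: "q1 \<noteq> q2" "norm (q1 - q2) = norm (q2 - q3)" "norm (q2 - q3) = norm (q3 - q1)"
    and bary: "m1 * u1 + m2 * u2 + m3 * u3 = 0"
    and orth: "m1 * (cnj q1 * u1) + m2 * (cnj q2 * u2) + m3 * (cnj q3 * u3) = 0"
    and unit: "m1 * (norm u1)\<^sup>2 + m2 * (norm u2)\<^sup>2 + m3 * (norm u3)\<^sup>2 = 1"
  defines "Z12 \<equiv> cnj (q1 - q2) * (u1 - u2)"
    and "Z13 \<equiv> cnj (q1 - q3) * (u1 - u3)"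
    and "Z23 \<equiv> cnj (q2 - q3) * (u2 - u3)"
  shows "(m1 * m2 * (Re Z12)\<^sup>2 + m1 * m3 * (Re Z13)\<^sup>2 + m2 * m3 * (Re Z23)\<^sup>2)
      * (m1 * m2 * (Im Z12)\<^sup>2 + m1 * m3 * (Im Z13)\<^sup>2 + m2 * m3 * (Im Z23)\<^sup>2)
      - (m1 * m2 * (Re Z12 * Im Z12) + m1 * m3 * (Re Z13 * Im Z13) + m2 * m3 * (Re Z23 * Im Z23))\<^sup>2
    = 3 / 4 * (m1 * m2 + m1 * m3 + m2 * m3) * norm (q1 - q2) ^ 4"
proof -
  obtain w where w: "w\<^sup>2 + w + 1 = 0" and q23: "q2 - q3 = cnj w * (q1 - q2)"
    and u: "m2 * u2 = w * (m1 * u1)" "m3 * u3 = w\<^sup>2 * (m1 * u1)"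
    using shape_vector_form[OF tri bary orth] .
  have w': "w * w = - w - 1" using w by (simp add: power2_eq_square eq_neg_iff_add_eq_0 algebra_simps)
  have "w ^ 3 - 1 = (w - 1) * (w\<^sup>2 + w + 1)" by (simp add: eval_nat_numeral algebra_simps)
  then have w3: "w ^ 3 = 1" using w by simp
  have "norm w ^ 3 = 1" using arg_cong[OF w3, of norm] by (simp add: norm_power)
  then have nw: "norm w = 1" using power_eq_iff_eq_base[of 3 "norm w" 1] by simp
  then have ww: "w * cnj w = 1" by (simp add: complex_norm_square[symmetric] flip: complex_norm_square)
  \<comment> \<open>\<open>- w - 1\<close> and \<open>cnj w\<close> agree, being both inverse to \<open>w\<close>.\<close>
  have "w * (- w - 1) = - (w * w) - w" by (simp add: right_diff_distrib)
  also have "\<dots> = w * cnj w" by (simp add: w' ww)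
  finally have "w * cnj w = w * (- w - 1)" by (rule sym)
  then have cw: "cnj w = - w - 1"
    using nw by (subst (asm) mult_left_cancel) auto
  define c where "c = m1 * u1"
  define Z where "Z = cnj (q1 - q2) * c"
  define n1 n2 n3 where "n1 = inverse m1" and "n2 = inverse m2" and "n3 = inverse m3"
  define N where "N = n1 + n2 + n3"
  have mn: "m1 * n1 = 1" "m2 * n2 = 1" "m3 * n3 = 1" using m by (auto simp: n1_def n2_def n3_def)
  have us: "u1 = n1 * c" "u2 = n2 * (w * c)" "u3 = n3 * (w\<^sup>2 * c)"
    using m u by (auto simp: c_def n1_def n2_def n3_def field_simps)
  have Z12: "Z12 = Z * (n1 - n2 * w)"
    unfolding Z12_def us Z_def by (simp add: algebra_simps)
  have w2: "w\<^sup>2 = - w - 1" using w' by (simp add: power2_eq_square)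
  have "Z23 = Z * (w\<^sup>2 * n2 - w ^ 3 * n3)"
    unfolding Z23_def us Z_def q23 by (simp add: algebra_simps power2_eq_square power3_eq_cube)
  then have Z23: "Z23 = Z * (w\<^sup>2 * n2 - n3)"
    by (simp add: w3)
  have "q1 - q3 = (1 + cnj w) * (q1 - q2)" using q23 by (simp add: algebra_simps)
  also have "1 + cnj w = - w" by (simp add: cw)
  finally have "cnj (q1 - q3) = - (cnj w * cnj (q1 - q2))" by simp
  moreover have "cnj w = w\<^sup>2" using cw w2 by simp
  ultimately have q13: "cnj (q1 - q3) = - (w\<^sup>2 * cnj (q1 - q2))" by simp
  have "Z13 = Z * (w ^ 3 * w * n3 - w\<^sup>2 * n1)"
    unfolding Z13_def us Z_def q13 by (simp add: algebra_simps power2_eq_square power3_eq_cube)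
  then have Z13: "Z13 = Z * (w * n3 - w\<^sup>2 * n1)"
    by (simp add: w3)
  have re: "Re w = - 1 / 2"
    using arg_cong[OF cw, of Re] by simp
  have im: "(Im w)\<^sup>2 = 3 / 4"
    using nw re cmod_power2[of w] by (simp add: power2_eq_square)
  have zz: "Im (Z * x * cnj (Z * y)) = (norm Z)\<^sup>2 * Im (x * cnj y)" for x y
  proof -
    have "Z * x * cnj (Z * y) = (Z * cnj Z) * (x * cnj y)"
      by simp
    also have "\<dots> = of_real ((norm Z)\<^sup>2) * (x * cnj y)"
      by (simp only: complex_norm_square)
    finally have "Z * x * cnj (Z * y) = of_real ((norm Z)\<^sup>2) * (x * cnj y)" .
    moreover have "Im (of_real a * z) = a * Im z" for a z by simp
    ultimately show ?thesis by (simp only:)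
  qed
  have I1: "Im (Z12 * cnj Z23) = (norm Z)\<^sup>2 * Im w * N * n2"
    and I2: "Im (Z12 * cnj Z13) = - ((norm Z)\<^sup>2 * Im w * N * n1)"
    and I3: "Im (Z13 * cnj Z23) = - ((norm Z)\<^sup>2 * Im w * N * n3)"
    unfolding Z12 Z13 Z23 zz w2 N_def
    by (simp_all add: re algebra_simps)
  have "m1 * n1\<^sup>2 = n1" "m2 * n2\<^sup>2 = n2" "m3 * n3\<^sup>2 = n3"
    using mn by (simp_all add: power2_eq_square flip: mult.assoc)
  then have "m1 * (norm u1)\<^sup>2 = n1 * (norm c)\<^sup>2" "m2 * (norm u2)\<^sup>2 = n2 * (norm c)\<^sup>2"
    "m3 * (norm u3)\<^sup>2 = n3 * (norm c)\<^sup>2"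
    by (simp_all add: us norm_mult norm_power nw power_mult_distrib flip: mult.assoc)
  then have "(norm c)\<^sup>2 * N = m1 * (norm u1)\<^sup>2 + m2 * (norm u2)\<^sup>2 + m3 * (norm u3)\<^sup>2"
    unfolding N_def by (simp add: algebra_simps)
  then have cN: "(norm c)\<^sup>2 * N = 1" using unit by simp
  have ZN: "(norm Z)\<^sup>2 * N = (norm (q1 - q2))\<^sup>2"
    unfolding Z_def using cN by (simp add: norm_mult power_mult_distrib mult.assoc del: complex_cnj_diff)
  have cancel: "m1 * m2 * (m1 * m3) * n1\<^sup>2 = m2 * m3" "m1 * m2 * (m2 * m3) * n2\<^sup>2 = m1 * m3"
    "m1 * m3 * (m2 * m3) * n3\<^sup>2 = m1 * m2"
    using m by (simp_all add: n1_def n2_def n3_def power2_eq_square field_simps)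
  have "m1 * m2 * (m1 * m3) * (- ((norm Z)\<^sup>2 * Im w * N * n1))\<^sup>2
      + m1 * m2 * (m2 * m3) * ((norm Z)\<^sup>2 * Im w * N * n2)\<^sup>2
      + m1 * m3 * (m2 * m3) * (- ((norm Z)\<^sup>2 * Im w * N * n3))\<^sup>2
    = ((norm Z)\<^sup>2 * N)\<^sup>2 * (Im w)\<^sup>2 * (m1 * m2 * (m1 * m3) * n1\<^sup>2
      + m1 * m2 * (m2 * m3) * n2\<^sup>2 + m1 * m3 * (m2 * m3) * n3\<^sup>2)"
    by (simp add: power_mult_distrib algebra_simps)
  also have "\<dots> = 3 / 4 * (m1 * m2 + m1 * m3 + m2 * m3) * norm (q1 - q2) ^ 4"
    unfolding cancel im ZN by (simp add: algebra_simps)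
  finally show ?thesis
    unfolding weighted_gram_determinant I1 I2 I3 .
qed

section \<open>Characteristic polynomials of order two\<close>

lemma char_poly_2x2:
  assumes "A \<in> carrier_mat 2 2"
  shows "char_poly A = [: A $$ (0,0) * A $$ (1,1) - A $$ (0,1) * A $$ (1,0), - (A $$ (0,0) + A $$ (1,1)), 1 :]"
proof -
  have "char_poly A = Determinant.det (char_poly_matrix A)"
    by (simp add: char_poly_def)
  also have "\<dots> = [: A $$ (0,0) * A $$ (1,1) - A $$ (0,1) * A $$ (1,0), - (A $$ (0,0) + A $$ (1,1)), 1 :]"
    apply (subst laplace_expansion_column[of _ 2 0])
    using assms apply simp
    apply simp
    using assms
    apply (simp add: char_poly_matrix_def cofactor_def det_single numeral_2_eq_2 mat_delete_def)
    done
  finally show ?thesis .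
qed

text \<open>
  Vieta's formulas over a field that may lack roots: since the multiset of roots has two
  elements, splitting off the root \<open>x\<close> leaves a linear factor whose root is \<open>y\<close>.
\<close>

lemma monic_quadratic_proots:
  fixes s d x y :: "'a::field"
  assumes "proots [: d, s, 1 :] = {# x, y #}"
  shows "s = - (x + y)" "d = x * y"
proof -
  let ?p = "[: d, s, 1 :]"
  have "count (proots ?p) x > 0" using assms by simp
  then have "poly ?p x = 0" by (simp add: order_gt_0_iff)
  then have d: "d = - x * (s + x)" by (simp add: algebra_simps eq_neg_iff_add_eq_0)
  have p: "?p = [: - x, 1 :] * [: s + x, 1 :]" by (simp add: d algebra_simps)
  have "proots ?p = {# x, - (s + x) #}"
    unfolding p by (subst proots_mult) auto
  then have s: "- (s + x) = y" using assms by simp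
  then show "s = - (x + y)" by (simp add: algebra_simps flip: s)
  show "d = x * y" unfolding d s[symmetric] by (simp only: mult_minus_left mult_minus_right)
qed

section \<open>The plane as the complex numbers\<close>

text \<open>
  Reading the plane as the complex numbers makes \<open>J\<close> multiplication by \<open>\<i>\<close>, so that the
  constraints on the shape vector become complex linear.
\<close>

definition to_complex :: "real ^ 2 \<Rightarrow> complex" where
  "to_complex p = Complex (p $ 1) (p $ 2)"

lemma inner_to_complex: "p \<bullet> r = Re (cnj (to_complex p) * to_complex r)"
  by (simp add: to_complex_def inner_vec_def sum_2)

lemma norm_to_complex [simp]: "norm (to_complex p) = norm p"
  by (simp add: to_complex_def norm_vec_def L2_set_def sum_2 cmod_def)

lemma to_complex_diff: "to_complex (p - r) = to_complex p - to_complex r"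
  by (simp add: to_complex_def complex_eq_iff)

lemma to_complex_eq_iff [simp]: "to_complex p = to_complex r \<longleftrightarrow> p = r"
  by (simp add: to_complex_def complex_eq_iff vec_eq_iff forall_2)

lemma to_complex_J: "to_complex (J q $ i) = \<i> * to_complex (q $ i)"
  by (simp add: to_complex_def J_def complex_eq_iff)

lemma inner_separation_J:
  "(q $ i - q $ j) \<bullet> (J u $ i - J u $ j)
    = - Im (cnj (to_complex (q $ i) - to_complex (q $ j)) * (to_complex (u $ i) - to_complex (u $ j)))"
  by (simp add: inner_to_complex to_complex_diff to_complex_J algebra_simps)

lemma inner_separation:
  "(q $ i - q $ j) \<bullet> (u $ i - u $ j)
    = Re (cnj (to_complex (q $ i) - to_complex (q $ j)) * (to_complex (u $ i) - to_complex (u $ j)))"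
  by (simp add: inner_to_complex to_complex_diff)

lemma weighted_sum_eq_0_iff:
  "inner_M m u v1 = 0 \<and> inner_M m u v2 = 0 \<longleftrightarrow> (\<Sum>i\<in>UNIV. m $ i *\<^sub>R u $ i) = 0"
  by (simp add: inner_M_expand v1_def v2_def inner_vec_def sum_2 sum_3 vec_eq_iff forall_2)

section \<open>The reduced Hessian\<close>

text \<open>
  Lagrange's identity in polarized form; the general correction term is the inner product of the
  two weighted sums.
\<close>

lemma lagrange_identity:
  assumes "(\<Sum>i\<in>UNIV. m $ i *\<^sub>R u $ i) = 0"
  shows "pair_sum m (\<lambda>i j. (u $ i - u $ j) \<bullet> (w $ i - w $ j)) = (m $ 1 + m $ 2 + m $ 3) * inner_M m u w"
proof -
  have "pair_sum m (\<lambda>i j. (u $ i - u $ j) \<bullet> (w $ i - w $ j))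
      = (m $ 1 + m $ 2 + m $ 3) * inner_M m u w
        - (\<Sum>i\<in>UNIV. m $ i *\<^sub>R u $ i) \<bullet> (\<Sum>i\<in>UNIV. m $ i *\<^sub>R w $ i)"
    by (simp add: pair_sum_def inner_M_expand sum_3 inner_add_left
        inner_add_right inner_diff_left inner_diff_right algebra_simps)
  then show ?thesis using assms by simp
qed

lemma weighted_sum_J:
  assumes "(\<Sum>i\<in>UNIV. m $ i *\<^sub>R u $ i) = 0"
  shows "(\<Sum>i\<in>UNIV. m $ i *\<^sub>R J u $ i) = 0"
  using assms by (simp add: J_def sum_3 vec_eq_iff forall_2)

lemma lagrange_configuration_sides:
  assumes "lagrange_configuration m q"
  shows "collision_free q" "norm (q $ 1 - q $ 2) > 0"
    "norm (q $ 1 - q $ 3) = norm (q $ 1 - q $ 2)" "norm (q $ 2 - q $ 3) = norm (q $ 1 - q $ 2)"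
  using assms by (auto simp: lagrange_configuration_def collision_free_def dist_norm norm_minus_commute)

text \<open>
  Lagrange's identity, applied to the normalized triangle itself, fixes its side from the masses.
  This makes the squared angular velocity equal to total mass over cubed side (Kepler's third law).
\<close>

lemma lagrange_configuration_size:
  assumes q: "lagrange_configuration m q" "inner_M m q q = 1"
  defines "r \<equiv> norm (q $ 1 - q $ 2)"
  shows "m $ 1 + m $ 2 + m $ 3 = (m $ 1 * m $ 2 + m $ 1 * m $ 3 + m $ 2 * m $ 3) * r\<^sup>2"
    and "newton_U m q = (m $ 1 + m $ 2 + m $ 3) / r ^ 3"
proof -
  note sides = lagrange_configuration_sides[OF q(1), folded r_def]
  have "pair_sum m (\<lambda>i j. (norm (q $ i - q $ j))\<^sup>2) = m $ 1 + m $ 2 + m $ 3"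
    using lagrange_identity[of m q q] q by (simp add: lagrange_configuration_def power2_norm_eq_inner)
  then show T: "m $ 1 + m $ 2 + m $ 3 = (m $ 1 * m $ 2 + m $ 1 * m $ 3 + m $ 2 * m $ 3) * r\<^sup>2"
    by (simp add: pair_sum_def sides flip: r_def) (simp add: algebra_simps)
  have "newton_U m q = (m $ 1 * m $ 2 + m $ 1 * m $ 3 + m $ 2 * m $ 3) / r"
    by (simp add: newton_U_def sides add_divide_distrib flip: r_def)
  also have "\<dots> = (m $ 1 + m $ 2 + m $ 3) / r ^ 3"
    unfolding T using sides(2) by (simp add: power3_eq_cube power2_eq_square)
  finally show "newton_U m q = (m $ 1 + m $ 2 + m $ 3) / r ^ 3" .
qed

text \<open>
  When one of the two vectors has barycentre \<open>0\<close>, Lagrange's identity shows that the isotropic part of the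
  Hessian of the gravitational energy is the total mass over the cubed side times the mass metric.
  This is the centrifugal term with the opposite sign, and only the tidal part along the
  sides survives.
\<close>

lemma second_derivative_at_lagrange:
  assumes m: "m $ 1 > 0" "m $ 2 > 0" "m $ 3 > 0"
    and q: "lagrange_configuration m q" "inner_M m q q = 1"
    and u: "(\<Sum>i\<in>UNIV. m $ i *\<^sub>R u $ i) = 0"
  shows "second_derivative (effective_V m (sqrt (newton_U m q))) q u w
    = - 3 / norm (q $ 1 - q $ 2) ^ 5 * pair_sum m (\<lambda>i j.
        ((q $ i - q $ j) \<bullet> (u $ i - u $ j)) * ((q $ i - q $ j) \<bullet> (w $ i - w $ j)))"
proof -
  define r where "r = norm (q $ 1 - q $ 2)"
  define T where "T = m $ 1 + m $ 2 + m $ 3"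
  note sides = lagrange_configuration_sides[OF q(1), folded r_def]
  have k: "(sqrt (newton_U m q))\<^sup>2 = T / r ^ 3"
    using lagrange_configuration_size(2)[OF q] m sides(2) by (simp flip: r_def T_def) (simp add: T_def)
  have "second_derivative (effective_V m (sqrt (newton_U m q))) q u w
    = pair_sum m (\<lambda>i j. (u $ i - u $ j) \<bullet> (w $ i - w $ j)) / r ^ 3
      - 3 / r ^ 5 * pair_sum m (\<lambda>i j.
        ((q $ i - q $ j) \<bullet> (u $ i - u $ j)) * ((q $ i - q $ j) \<bullet> (w $ i - w $ j)))
      - T / r ^ 3 * inner_M m u w"
    unfolding second_derivative_effective_V[OF sides(1)] k
    by (simp add: pair_sum_def sides add_divide_distrib diff_divide_distrib algebra_simps flip: r_def)
  also have "\<dots> = - 3 / r ^ 5 * pair_sum m (\<lambda>i j.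
        ((q $ i - q $ j) \<bullet> (u $ i - u $ j)) * ((q $ i - q $ j) \<bullet> (w $ i - w $ j)))"
    unfolding lagrange_identity[OF u] by (simp add: T_def)
  finally show ?thesis by (simp add: r_def)
qed

lemma complex_barycentre:
  fixes m :: "real ^ 3" and u :: config
  assumes "(\<Sum>i\<in>UNIV. m $ i *\<^sub>R u $ i) = 0"
  shows "m $ 1 * to_complex (u $ 1) + m $ 2 * to_complex (u $ 2) + m $ 3 * to_complex (u $ 3) = 0"
  using assms by (simp add: sum_3 to_complex_def complex_eq_iff vec_eq_iff forall_2)

text \<open>
  The two real orthogonality relations are the real and imaginary parts of one Hermitian relation.
\<close>

lemma complex_orthogonality:
  assumes "inner_M m u q = 0" "inner_M m u (J q) = 0"
  shows "m $ 1 * (cnj (to_complex (q $ 1)) * to_complex (u $ 1))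
    + m $ 2 * (cnj (to_complex (q $ 2)) * to_complex (u $ 2))
    + m $ 3 * (cnj (to_complex (q $ 3)) * to_complex (u $ 3)) = 0"
  using assms
  by (simp add: inner_M_expand inner_to_complex to_complex_J complex_eq_iff algebra_simps)

lemma reduced_hessian_carrier: "reduced_hessian f x b \<in> carrier_mat 2 2"
  by (simp add: reduced_hessian_def)

lemma reduced_hessian_nth:
  "i < 2 \<Longrightarrow> j < 2 \<Longrightarrow> reduced_hessian f x b $$ (i, j) = second_derivative f x (b ! i) (b ! j)"
  by (simp add: reduced_hessian_def)

text \<open>
  The reduced Hessian is \<open>-3 / r ^ 5\<close> times the Gram matrix, weighted by products of masses, of the
  scalar products of \<open>u\<close> and \<open>J u\<close> with the sides. The two scalar products with a side are the real part and minus the imaginary part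
  of one complex number \<open>Z i j\<close>; hence the trace is a sum of squared moduli, given by Lagrange's
  identity, and the determinant is that of \<open>shape_gram_determinant\<close>.
\<close>

lemma reduced_hessian_trace_det:
  fixes m :: "real ^ 3" and q u :: config
  assumes m: "m $ 1 > 0" "m $ 2 > 0" "m $ 3 > 0"
    and q: "lagrange_configuration m q" "inner_M m q q = 1"
    and unit: "inner_M m u u = 1"
    and orth: "inner_M m u v1 = 0" "inner_M m u v2 = 0" "inner_M m u q = 0" "inner_M m u (J q) = 0"
  defines "r \<equiv> norm (q $ 1 - q $ 2)"
    and "H \<equiv> reduced_hessian (effective_V m (sqrt (newton_U m q))) q [u, J u]"
  shows "H $$ (0,0) + H $$ (1,1) = - 3 * (m $ 1 + m $ 2 + m $ 3) / r ^ 3"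
    and "H $$ (0,0) * H $$ (1,1) - H $$ (0,1) * H $$ (1,0)
      = 27 / 4 * (m $ 1 * m $ 2 + m $ 1 * m $ 3 + m $ 2 * m $ 3) / r ^ 6"
proof -
  note sides = lagrange_configuration_sides[OF q(1), folded r_def]
  have u: "(\<Sum>i\<in>UNIV. m $ i *\<^sub>R u $ i) = 0"
    using orth weighted_sum_eq_0_iff by blast
  define Z where "Z i j = cnj (to_complex (q $ i) - to_complex (q $ j)) * (to_complex (u $ i) - to_complex (u $ j))" for i j
  define A where "A = pair_sum m (\<lambda>i j. (Re (Z i j))\<^sup>2)"
  define C where "C = pair_sum m (\<lambda>i j. (Im (Z i j))\<^sup>2)"
  define B where "B = pair_sum m (\<lambda>i j. Re (Z i j) * Im (Z i j))"
  note D = second_derivative_at_lagrange[OF m q, folded r_def]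
  have along: "(q $ i - q $ j) \<bullet> (u $ i - u $ j) = Re (Z i j)"
    "(q $ i - q $ j) \<bullet> (J u $ i - J u $ j) = - Im (Z i j)" for i j
    unfolding Z_def by (rule inner_separation inner_separation_J)+
  have H: "H $$ (0,0) = - 3 / r ^ 5 * A" "H $$ (1,1) = - 3 / r ^ 5 * C"
    "H $$ (0,1) = 3 / r ^ 5 * B" "H $$ (1,0) = 3 / r ^ 5 * B"
    by (simp_all add: H_def A_def B_def C_def reduced_hessian_nth D[OF u] D[OF weighted_sum_J[OF u]]
        along pair_sum_def power2_eq_square)
       (simp_all add: minus_divide_left algebra_simps)
  have side: "norm (to_complex (q $ i) - to_complex (q $ j)) = norm (q $ i - q $ j)" for i j
    by (simp flip: to_complex_diff)
  have "A + C = pair_sum m (\<lambda>i j. (norm (Z i j))\<^sup>2)"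
    by (simp add: A_def C_def pair_sum_def cmod_power2 algebra_simps)
  also have "\<dots> = r\<^sup>2 * pair_sum m (\<lambda>i j. (norm (u $ i - u $ j))\<^sup>2)"
    by (simp add: pair_sum_def Z_def norm_mult power_mult_distrib side sides flip: to_complex_diff r_def)
       (simp add: algebra_simps)
  also have "\<dots> = r\<^sup>2 * (m $ 1 + m $ 2 + m $ 3)"
    using lagrange_identity[OF u, of u] unit by (simp add: power2_norm_eq_inner)
  finally have trace: "A + C = r\<^sup>2 * (m $ 1 + m $ 2 + m $ 3)" .
  have det: "A * C - B\<^sup>2 = 3 / 4 * (m $ 1 * m $ 2 + m $ 1 * m $ 3 + m $ 2 * m $ 3) * r ^ 4"
    unfolding A_def B_def C_def pair_sum_def Z_def
    unfolding r_def side[symmetric]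
  proof (rule shape_gram_determinant[OF m])
    show "to_complex (q $ 1) \<noteq> to_complex (q $ 2)" using sides(1) by (simp add: collision_free_def)
    show "norm (to_complex (q $ 1) - to_complex (q $ 2)) = norm (to_complex (q $ 2) - to_complex (q $ 3))"
      "norm (to_complex (q $ 2) - to_complex (q $ 3)) = norm (to_complex (q $ 3) - to_complex (q $ 1))"
      unfolding side using sides by (simp_all add: norm_minus_commute r_def)
    show "m $ 1 * (norm (to_complex (u $ 1)))\<^sup>2 + m $ 2 * (norm (to_complex (u $ 2)))\<^sup>2
        + m $ 3 * (norm (to_complex (u $ 3)))\<^sup>2 = 1"
      using unit by (simp add: inner_M_expand power2_norm_eq_inner)
  qed (use complex_barycentre[OF u] complex_orthogonality orth in auto)
  have r: "r ^ 5 = r\<^sup>2 * r ^ 3" "r ^ 10 = r ^ 4 * r ^ 6"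
    by (simp_all flip: power_add)
  have "H $$ (0,0) + H $$ (1,1) = - 3 / r ^ 5 * (A + C)"
    unfolding H by (rule distrib_left[symmetric])
  also have "\<dots> = - 3 * (m $ 1 + m $ 2 + m $ 3) / r ^ 3"
  proof -
    have cancel: "- 3 / (x * y) * (x * t) = - 3 * t / y" if "x \<noteq> 0" for x y t :: real
      using that by simp
    show ?thesis
      unfolding trace r by (rule cancel) (use sides(2) in simp)
  qed
  finally show "H $$ (0,0) + H $$ (1,1) = - 3 * (m $ 1 + m $ 2 + m $ 3) / r ^ 3" .
  have "H $$ (0,0) * H $$ (1,1) - H $$ (0,1) * H $$ (1,0) = 9 / (r ^ 5)\<^sup>2 * (A * C - B\<^sup>2)"
    unfolding H by (simp add: power2_eq_square right_diff_distrib)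
  also have "(r ^ 5)\<^sup>2 = r ^ 10" by (simp flip: power_mult)
  also have "9 / r ^ 10 * (A * C - B\<^sup>2)
      = 27 / 4 * (m $ 1 * m $ 2 + m $ 1 * m $ 3 + m $ 2 * m $ 3) / r ^ 6"
  proof -
    have cancel: "9 / (x * y) * (3 / 4 * t * x) = 27 / 4 * t / y" if "x \<noteq> 0" for x y t :: real
      using that by simp
    show ?thesis
      unfolding det r by (rule cancel) (use sides(2) in simp)
  qed
  finally show "H $$ (0,0) * H $$ (1,1) - H $$ (0,1) * H $$ (1,0)
      = 27 / 4 * (m $ 1 * m $ 2 + m $ 1 * m $ 3 + m $ 2 * m $ 3) / r ^ 6" .
qed

section \<open>Routh's criterion\<close>

text \<open>
  Squaring twice. Since the sum of \<open>a\<close> and \<open>b\<close> is positive, the sign of the product makes both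
  numbers nonnegative; the factor \<open>3 / 2\<close> leaves half of \<open>K\<^sup>2\<close> for twice the root of the product.
\<close>

lemma sum_of_square_roots_less_iff:
  fixes a b K :: real
  assumes "a * b \<ge> 0" "a + b = 3 / 2 * K\<^sup>2" "K > 0"
  shows "sqrt a + sqrt b < sqrt 2 * K \<longleftrightarrow> 16 * (a * b) < K ^ 4"
proof -
  have ab: "a \<ge> 0" "b \<ge> 0"
  proof -
    have "a + b > 0" unfolding assms(2) using assms(3) by simp
    with assms(1) show "a \<ge> 0" "b \<ge> 0"
      by (auto simp: zero_le_mult_iff)
  qed
  have less_iff_squares: "x < y \<longleftrightarrow> x\<^sup>2 < y\<^sup>2" if "x \<ge> 0" "y \<ge> 0" for x y :: real
    using power_mono_iff[of y x 2] that by (simp flip: not_le)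
  have "sqrt a + sqrt b < sqrt 2 * K \<longleftrightarrow> (sqrt a + sqrt b)\<^sup>2 < (sqrt 2 * K)\<^sup>2"
    using ab assms(3) by (intro less_iff_squares) auto
  also have "\<dots> \<longleftrightarrow> a + b + 2 * sqrt (a * b) < 2 * K\<^sup>2"
    using ab by (simp add: power2_sum power_mult_distrib real_sqrt_mult mult.assoc)
  also have "\<dots> \<longleftrightarrow> 4 * sqrt (a * b) < K\<^sup>2"
    unfolding assms(2) by auto
  also have "\<dots> \<longleftrightarrow> (4 * sqrt (a * b))\<^sup>2 < (K\<^sup>2)\<^sup>2"
    using assms(1) by (intro less_iff_squares) auto
  also have "\<dots> \<longleftrightarrow> 16 * (a * b) < K ^ 4"
    using assms(1) by (simp add: power_mult_distrib flip: power_mult)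
  finally show ?thesis .
qed

theorem proposition5p1:
  fixes m :: "real ^ 3" and q0 v5 :: config and k \<alpha> \<beta> :: real
  assumes "m $ 1 > 0" and "m $ 2 > 0" and "m $ 3 > 0"
    and "lagrange_configuration m q0"
    and "inner_M m q0 q0 = 1"
    and "k = sqrt (newton_U m q0)"
    and "inner_M m v5 v5 = 1"
    and "inner_M m v5 v1 = 0" and "inner_M m v5 v2 = 0"
    and "inner_M m v5 q0 = 0" and "inner_M m v5 (J q0) = 0"
    and "{# - \<mu> / 2. \<mu> \<in># proots (char_poly (reduced_hessian (effective_V m k) q0 [v5, J v5])) #}
           = {# \<alpha>, \<beta> #}"
  shows "sqrt \<alpha> + sqrt \<beta> < sqrt 2 * k \<longleftrightarrow>
    (m $ 1 * m $ 2 + m $ 1 * m $ 3 + m $ 2 * m $ 3) / (m $ 1 + m $ 2 + m $ 3)\<^sup>2 < 1 / 27"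
proof -
  define H where "H = reduced_hessian (effective_V m k) q0 [v5, J v5]"
  define P where "P = m $ 1 * m $ 2 + m $ 1 * m $ 3 + m $ 2 * m $ 3"
  define T where "T = m $ 1 + m $ 2 + m $ 3"
  define r where "r = norm (q0 $ 1 - q0 $ 2)"
  have T: "T > 0" and P: "P > 0" and r: "r > 0"
    using assms(1-3) lagrange_configuration_sides(2)[OF assms(4)]
    by (auto simp: T_def P_def r_def add_pos_pos)
  have tr: "H $$ (0,0) + H $$ (1,1) = - 3 * T / r ^ 3"
    and det: "H $$ (0,0) * H $$ (1,1) - H $$ (0,1) * H $$ (1,0) = 27 / 4 * P / r ^ 6"
    using reduced_hessian_trace_det[OF assms(1-5,7-11)]
    by (simp_all add: H_def P_def T_def r_def assms(6))
  have U: "newton_U m q0 = T / r ^ 3"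
    using lagrange_configuration_size(2)[OF assms(4,5)] by (simp add: T_def r_def)
  have k: "k > 0" "k\<^sup>2 = T / r ^ 3"
    using T r by (simp_all add: assms(6) U)
  have "proots (char_poly H) = image_mset (\<lambda>x. - 2 * x) {# - \<mu> / 2. \<mu> \<in># proots (char_poly H) #}"
    by (simp add: image_mset.compositionality o_def)
  also have "\<dots> = {# - 2 * \<alpha>, - 2 * \<beta> #}"
    using assms(12) by (simp add: H_def)
  also have "char_poly H = [: 27 / 4 * P / r ^ 6, - (- 3 * T / r ^ 3), 1 :]"
    unfolding tr[symmetric] det[symmetric]
    by (rule char_poly_2x2) (simp add: H_def reduced_hessian_carrier)
  finally have "proots [: 27 / 4 * P / r ^ 6, - (- 3 * T / r ^ 3), 1 :] = {# - 2 * \<alpha>, - 2 * \<beta> #}" .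
  note vieta = monic_quadratic_proots[OF this]
  have sum: "\<alpha> + \<beta> = 3 / 2 * k\<^sup>2"
    using vieta(1) by (simp add: k)
  have prod: "16 * (\<alpha> * \<beta>) = 27 * P / r ^ 6"
    using vieta(2) by simp
  have "\<alpha> * \<beta> \<ge> 0"
    using prod P r by (smt (verit) divide_pos_pos zero_less_power)
  then have "sqrt \<alpha> + sqrt \<beta> < sqrt 2 * k \<longleftrightarrow> 16 * (\<alpha> * \<beta>) < k ^ 4"
    using sum k by (intro sum_of_square_roots_less_iff)
  also have "k ^ 4 = (k\<^sup>2)\<^sup>2" by (simp flip: power_mult)
  also have "\<dots> = T\<^sup>2 / r ^ 6" by (simp add: k power_divide flip: power_mult)
  also have "16 * (\<alpha> * \<beta>) < T\<^sup>2 / r ^ 6 \<longleftrightarrow> P / T\<^sup>2 < 1 / 27"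
    unfolding prod using T r by (simp add: divide_simps mult.commute)
  finally show ?thesis by (simp add: P_def T_def)
qed

end
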